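(* Let $V\in\mathbb{C}[q_1,q_2,q_3]$ be a homogeneous polynomial potential of degree $3$ such that all proper Darboux points of $V$ are simple, $V$ has an improper isotropic Darboux point $[d_0]$, and $V$ has no non-isotropic improper Darboux point. If $\operatorname{rank}V''(d_0)=0$, then $V$ admits a first integral which is a (non-zero) linear form in $\mathbb{C}[p_1,p_2,p_3]$.
   Context: For a potential $V$ consider the complex Hamiltonian system with $H=\frac12(p_1^2+p_2^2+p_3^2)+V(q)$, i.e. $\dot q=p$, $\dot p=-V'(q)$, $V'=\operatorname{grad}V$; a first integral of $V$ means a first integral of this system. $V''$ denotes the Hessian matrix. A point $[d]\in\mathbb{CP}^2$ ($d\in\mathbb{C}^3\setminus\{0\}$) is a Darboux point of $V$ if $d\wedge V'(d)=0$, i.e. $V'(d)$ is proportional to $d$. It is proper if $V'(d)\neq0$ and improper if $V'(d)=0$. It is isotropic if $d_1^2+d_2^2+d_3^2=0$. The set of Darboux points is the projective algebraic set defined by the polynomials $q_i\partial V/\partial q_j-q_j\partial V/\partial q_i$; a Darboux point is simple if it is an isolated point of multiplicity one of this set. For a proper Darboux point, with representative chosen so that $V'(d)=d$, this is equivalent to invertibility of $V''(d)-\mathrm{Id}$. *)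

theory Defs
  imports "HOL-Analysis.Analysis" "HOL-Library.FuncSet"
begin

text \<open>Since the complex field is infinite, polynomials over it are identified with the polynomial
  functions they induce. The zero polynomial counts as homogeneous of every degree.\<close>

definition homogeneous_poly :: "nat \<Rightarrow> (complex^'n \<Rightarrow> complex) \<Rightarrow> bool" where
  "homogeneous_poly k V \<longleftrightarrow>
     (\<exists>(A :: (nat^'n) set) c. finite A \<and> (\<forall>\<alpha>\<in>A. (\<Sum>i\<in>UNIV. \<alpha> $ i) = k) \<and>
        (\<forall>q. V q = (\<Sum>\<alpha>\<in>A. c \<alpha> * (\<Prod>i\<in>UNIV. (q $ i) ^ (\<alpha> $ i)))))"

definition partial :: "'n \<Rightarrow> (complex^'n \<Rightarrow> complex) \<Rightarrow> complex^'n \<Rightarrow> complex" where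
  "partial i V q = deriv (\<lambda>t. V (q + t *s axis i 1)) 0"

definition grad :: "(complex^'n \<Rightarrow> complex) \<Rightarrow> complex^'n \<Rightarrow> complex^'n" where
  "grad V q = (\<chi> i. partial i V q)"

definition hessian :: "(complex^'n \<Rightarrow> complex) \<Rightarrow> complex^'n \<Rightarrow> complex^'n^'n" where
  "hessian V q = (\<chi> i j. partial i (partial j V) q)"

text \<open>A point of projective space is given by a nonzero representative; all notions below are
  invariant under rescaling the representative when \<open>V\<close> is homogeneous.\<close>

definition darboux_poly ::
  "(complex^'n \<Rightarrow> complex) \<Rightarrow> 'n \<times> 'n \<Rightarrow> complex^'n \<Rightarrow> complex" where
  "darboux_poly V ij q = q $ fst ij * grad V q $ snd ij - q $ snd ij * grad V q $ fst ij"

definition darboux_point :: "(complex^'n \<Rightarrow> complex) \<Rightarrow> complex^'n \<Rightarrow> bool" where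
  "darboux_point V d \<longleftrightarrow> d \<noteq> 0 \<and> (\<forall>ij. darboux_poly V ij d = 0)"

definition proper_darboux_point :: "(complex^'n \<Rightarrow> complex) \<Rightarrow> complex^'n \<Rightarrow> bool" where
  "proper_darboux_point V d \<longleftrightarrow> darboux_point V d \<and> grad V d \<noteq> 0"

definition improper_darboux_point :: "(complex^'n \<Rightarrow> complex) \<Rightarrow> complex^'n \<Rightarrow> bool" where
  "improper_darboux_point V d \<longleftrightarrow> darboux_point V d \<and> grad V d = 0"

definition isotropic :: "complex^'n \<Rightarrow> bool" where
  "isotropic d \<longleftrightarrow> (\<Sum>i\<in>UNIV. (d $ i)\<^sup>2) = 0"

text \<open>Multiplicity of the projective scheme cut out by homogeneous polynomials \<open>F i\<close> at \<open>[d]\<close>: the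
  complex dimension of the quotient of the local ring of projective space at \<open>[d]\<close> by the ideal
  generated by the \<open>F i\<close>. Elements of the local ring are fractions of homogeneous polynomials of
  equal degree with denominator not vanishing at \<open>d\<close>. They are represented by functions that agree
  with such a fraction near \<open>d\<close>, and two fractions are equal iff they agree near \<open>d\<close>.\<close>

definition proj_local_ring :: "complex^'n \<Rightarrow> (complex^'n \<Rightarrow> complex) set" where
  "proj_local_ring d =
     {h. \<exists>k f g. homogeneous_poly k f \<and> homogeneous_poly k g \<and> g d \<noteq> 0 \<and>
           (\<forall>\<^sub>F q in nhds d. h q = f q / g q)}"

definition proj_local_ideal ::
  "('i::finite \<Rightarrow> complex^'n \<Rightarrow> complex) \<Rightarrow> complex^'n \<Rightarrow> (complex^'n \<Rightarrow> complex) set" where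
  "proj_local_ideal F d =
     {h. \<exists>a b. (\<forall>i. (\<exists>k. homogeneous_poly k (a i)) \<and> b i d \<noteq> 0 \<and>
              (\<exists>m. homogeneous_poly m (\<lambda>q. a i q * F i q) \<and> homogeneous_poly m (b i))) \<and>
           (\<forall>\<^sub>F q in nhds d. h q = (\<Sum>i\<in>UNIV. a i q * F i q / b i q))}"

text \<open>The functions \<open>e 0, \<dots>, e (m - 1)\<close> below form a basis of the quotient of the local ring by
  the ideal.\<close>

definition has_proj_multiplicity ::
  "('i::finite \<Rightarrow> complex^'n \<Rightarrow> complex) \<Rightarrow> complex^'n \<Rightarrow> nat \<Rightarrow> bool" where
  "has_proj_multiplicity F d m \<longleftrightarrow>
     (\<exists>e :: nat \<Rightarrow> complex^'n \<Rightarrow> complex. (\<forall>j<m. e j \<in> proj_local_ring d) \<and>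
        (\<forall>h\<in>proj_local_ring d. \<exists>!c. c \<in> {..<m} \<rightarrow>\<^sub>E (UNIV :: complex set) \<and>
           (\<lambda>q. h q - (\<Sum>j<m. c j * e j q)) \<in> proj_local_ideal F d))"

definition simple_darboux_point :: "(complex^'n \<Rightarrow> complex) \<Rightarrow> complex^'n \<Rightarrow> bool" where
  "simple_darboux_point V d \<longleftrightarrow> darboux_point V d \<and>
     (\<exists>U. open U \<and> d \<in> U \<and> (\<forall>q\<in>U. darboux_point V q \<longrightarrow> (\<exists>c. q = c *s d))) \<and>
     has_proj_multiplicity (darboux_poly V) d 1"

text \<open>Complex-time solutions, on a domain \<open>T\<close>, of Hamilton's equations for
  \<open>H = (p\<^sub>1\<^sup>2 + \<dots> + p\<^sub>n\<^sup>2) / 2 + V(q)\<close>.\<close>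

definition hamiltonian_solution ::
  "(complex^'n \<Rightarrow> complex) \<Rightarrow> complex set \<Rightarrow> (complex \<Rightarrow> complex^'n) \<Rightarrow> (complex \<Rightarrow> complex^'n) \<Rightarrow> bool"
  where
  "hamiltonian_solution V T q p \<longleftrightarrow>
     (\<forall>t\<in>T. \<forall>i. ((\<lambda>s. q s $ i) has_field_derivative p t $ i) (at t) \<and>
                ((\<lambda>s. p s $ i) has_field_derivative - (grad V (q t) $ i)) (at t))"

definition first_integral ::
  "(complex^'n \<Rightarrow> complex) \<Rightarrow> (complex^'n \<Rightarrow> complex^'n \<Rightarrow> complex) \<Rightarrow> bool" where
  "first_integral V F \<longleftrightarrow>
     (\<forall>T q p. open T \<and> connected T \<and> hamiltonian_solution V T q p \<longrightarrow>
        (\<lambda>t. F (q t) (p t)) constant_on T)"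

end

theory Submission
  imports Defs
begin

text \<open>For a cubic form, \<open>2 \<langle>d, V'(q)\<rangle> = \<langle>q, V''(d) q\<rangle>\<close>, both being the third
  derivative of \<open>V\<close> applied to \<open>(d, q, q)\<close>. If \<open>V''(d\<^sub>0) = 0\<close>, the force is therefore orthogonal to \<open>d\<^sub>0\<close> everywhere,
  and \<open>\<langle>d\<^sub>0, p\<rangle>\<close> is conserved.\<close>

text \<open>A positive degree forces a positive exponent; lowering that exponent by one splits off
  one variable. This is the induction step for writing monomials as plain products of
  coordinates.\<close>

lemma monomial_Suc:
  fixes \<alpha> :: "nat^'n"
  assumes "(\<Sum>i\<in>UNIV. \<alpha> $ i) = Suc k"
  obtains i and \<beta> :: "nat^'n" where "(\<Sum>i\<in>UNIV. \<beta> $ i) = k"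
    and "\<And>q :: complex^'n. (\<Prod>j\<in>UNIV. q $ j ^ (\<alpha> $ j)) = q $ i * (\<Prod>j\<in>UNIV. q $ j ^ (\<beta> $ j))"
proof -
  obtain i where i: "\<alpha> $ i > 0"
    using assms by (metis gr0I nat.distinct(1) sum.neutral)
  define \<beta> :: "nat^'n" where "\<beta> = (\<chi> j. if j = i then \<alpha> $ j - 1 else \<alpha> $ j)"
  have "(\<Sum>j\<in>UNIV - {i}. \<beta> $ j) = (\<Sum>j\<in>UNIV - {i}. \<alpha> $ j)"
    by (intro sum.cong) (auto simp: \<beta>_def)
  then have 1: "(\<Sum>i\<in>UNIV. \<beta> $ i) = k"
    using assms i sum.remove[of UNIV i "($) \<alpha>"] sum.remove[of UNIV i "($) \<beta>"]
    by (simp add: \<beta>_def)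
  have 2: "(\<Prod>j\<in>UNIV. q $ j ^ (\<alpha> $ j)) = q $ i * (\<Prod>j\<in>UNIV. q $ j ^ (\<beta> $ j))"
    for q :: "complex^'n"
  proof -
    have "(\<Prod>j\<in>UNIV - {i}. q $ j ^ (\<beta> $ j)) = (\<Prod>j\<in>UNIV - {i}. q $ j ^ (\<alpha> $ j))"
      by (intro prod.cong) (auto simp: \<beta>_def)
    moreover have "q $ i ^ (\<alpha> $ i) = q $ i * q $ i ^ (\<beta> $ i)"
      using i by (simp add: \<beta>_def flip: power_Suc)
    ultimately show ?thesis
      by (simp add: prod.remove[of UNIV i])
  qed
  from 1 2 show thesis by (rule that)
qed

text \<open>Splitting off a variable three times leaves a monomial of degree 0, the constant 1.
  Products of three coordinates, repetitions allowed, can be differentiated by the Leibniz rule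
  without case distinctions on exponents.\<close>

lemma cubic_monomial:
  fixes \<alpha> :: "nat^'n"
  assumes "(\<Sum>i\<in>UNIV. \<alpha> $ i) = 3"
  shows "\<exists>i j k. \<forall>q :: complex^'n. (\<Prod>l\<in>UNIV. q $ l ^ (\<alpha> $ l)) = q $ i * q $ j * q $ k"
proof -
  obtain i \<beta> where \<beta>: "(\<Sum>i\<in>UNIV. \<beta> $ i) = Suc (Suc 0)"
    and i: "\<And>q :: complex^'n. (\<Prod>l\<in>UNIV. q $ l ^ (\<alpha> $ l)) = q $ i * (\<Prod>l\<in>UNIV. q $ l ^ (\<beta> $ l))"
    using assms unfolding numeral_3_eq_3 by (rule monomial_Suc) blast
  obtain j \<gamma> where \<gamma>: "(\<Sum>i\<in>UNIV. \<gamma> $ i) = Suc 0"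
    and j: "\<And>q :: complex^'n. (\<Prod>l\<in>UNIV. q $ l ^ (\<beta> $ l)) = q $ j * (\<Prod>l\<in>UNIV. q $ l ^ (\<gamma> $ l))"
    using \<beta> by (rule monomial_Suc) blast
  obtain k \<delta> where \<delta>: "(\<Sum>i\<in>UNIV. \<delta> $ i) = 0"
    and k: "\<And>q :: complex^'n. (\<Prod>l\<in>UNIV. q $ l ^ (\<gamma> $ l)) = q $ k * (\<Prod>l\<in>UNIV. q $ l ^ (\<delta> $ l))"
    using \<gamma> by (rule monomial_Suc) blast
  have "(\<Prod>l\<in>UNIV. q $ l ^ (\<delta> $ l)) = 1" for q :: "complex^'n"
    using \<delta> by simp
  then show ?thesis
    by (intro exI[of _ i] exI[of _ j] exI[of _ k]) (simp add: i j k)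
qed

lemma homogeneous_poly_3E:
  fixes V :: "complex^'n \<Rightarrow> complex"
  assumes "homogeneous_poly 3 V"
  obtains A :: "(nat^'n) set" and c I J K
  where "\<And>q. V q = (\<Sum>\<alpha>\<in>A. c \<alpha> * (q $ I \<alpha> * q $ J \<alpha> * q $ K \<alpha>))"
proof -
  obtain A :: "(nat^'n) set" and c where A: "\<And>\<alpha>. \<alpha> \<in> A \<Longrightarrow> (\<Sum>i\<in>UNIV. \<alpha> $ i) = 3"
    and V: "\<And>q. V q = (\<Sum>\<alpha>\<in>A. c \<alpha> * (\<Prod>i\<in>UNIV. q $ i ^ (\<alpha> $ i)))"
    using assms unfolding homogeneous_poly_def by blast
  obtain I J K where IJK: "\<And>\<alpha> q. \<alpha> \<in> A \<Longrightarrow>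
      (\<Prod>l\<in>UNIV. (q :: complex^'n) $ l ^ (\<alpha> $ l)) = q $ I \<alpha> * q $ J \<alpha> * q $ K \<alpha>"
    using cubic_monomial[OF A] by metis
  show thesis
    by (rule that[where A = A and c = c and I = I and J = J and K = K]) (simp add: V IJK)
qed

text \<open>Both sides are linear in \<open>V\<close>, so they can be compared summand by summand on
  products of three coordinates. There each side is a sum over the ways to put \<open>d\<close> in
  one slot and \<open>q\<close> in the other two.\<close>

lemma hessian_polarization:
  fixes V :: "complex^'n \<Rightarrow> complex"
  assumes "homogeneous_poly 3 V"
  shows "(\<Sum>i\<in>UNIV. \<Sum>j\<in>UNIV. q $ i * q $ j * hessian V d $ i $ j) = 2 * (\<Sum>i\<in>UNIV. d $ i * grad V q $ i)"
proof -
  obtain A :: "(nat^'n) set" and c I J K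
    where V: "\<And>q. V q = (\<Sum>\<alpha>\<in>A. c \<alpha> * (q $ I \<alpha> * q $ J \<alpha> * q $ K \<alpha>))"
    using assms by (rule homogeneous_poly_3E) blast
  \<comment> \<open>Kronecker's delta stands for the derivative of one coordinate along another. The
    contractions below put it last in each product, so that the fact \<open>\<delta>\<close>
    collapses the sums.\<close>
  define \<delta> :: "'n \<Rightarrow> 'n \<Rightarrow> complex" where "\<delta> i j = (if i = j then 1 else 0)" for i j
  have \<delta>: "(\<Sum>i\<in>UNIV. f i * \<delta> i j) = f j" for f j
    by (simp add: \<delta>_def if_distrib cong: if_cong)
  have axis: "axis l 1 $ i = \<delta> l i" for l i
    by (auto simp: axis_def \<delta>_def)
  have grad: "partial l V q = (\<Sum>\<alpha>\<in>A. c \<alpha> *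
      (\<delta> l (I \<alpha>) * q $ J \<alpha> * q $ K \<alpha> + q $ I \<alpha> * \<delta> l (J \<alpha>) * q $ K \<alpha> + q $ I \<alpha> * q $ J \<alpha> * \<delta> l (K \<alpha>)))"
    for l q
    unfolding partial_def V
    by (rule DERIV_imp_deriv) (auto intro!: derivative_eq_intros sum.cong simp: axis algebra_simps)
  \<comment> \<open>Six terms: one for each ordered choice of two distinct slots, the first hit by
    \<open>l\<close> and the second by \<open>m\<close>.\<close>
  have hess: "partial m (partial l V) q = (\<Sum>\<alpha>\<in>A. c \<alpha> *
      (\<delta> l (I \<alpha>) * \<delta> m (J \<alpha>) * q $ K \<alpha> + \<delta> l (I \<alpha>) * q $ J \<alpha> * \<delta> m (K \<alpha>)
     + \<delta> m (I \<alpha>) * \<delta> l (J \<alpha>) * q $ K \<alpha> + q $ I \<alpha> * \<delta> l (J \<alpha>) * \<delta> m (K \<alpha>)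
     + \<delta> m (I \<alpha>) * q $ J \<alpha> * \<delta> l (K \<alpha>) + q $ I \<alpha> * \<delta> m (J \<alpha>) * \<delta> l (K \<alpha>)))"
    for m l q
    unfolding partial_def[of m] grad
    by (rule DERIV_imp_deriv) (auto intro!: derivative_eq_intros sum.cong simp: axis algebra_simps)
  \<comment> \<open>The derivative of one summand of \<open>V\<close> at \<open>q\<close> in
    direction \<open>d\<close>.\<close>
  define P where "P \<alpha> = c \<alpha> * (d $ I \<alpha> * q $ J \<alpha> * q $ K \<alpha> + q $ I \<alpha> * d $ J \<alpha> * q $ K \<alpha>
     + q $ I \<alpha> * q $ J \<alpha> * d $ K \<alpha>)" for \<alpha>
  have "(\<Sum>i\<in>UNIV. d $ i * grad V q $ i) = (\<Sum>\<alpha>\<in>A. \<Sum>l\<in>UNIV.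
        (d $ l * c \<alpha> * q $ J \<alpha> * q $ K \<alpha>) * \<delta> l (I \<alpha>)
      + (d $ l * c \<alpha> * q $ I \<alpha> * q $ K \<alpha>) * \<delta> l (J \<alpha>)
      + (d $ l * c \<alpha> * q $ I \<alpha> * q $ J \<alpha>) * \<delta> l (K \<alpha>))"
    by (subst sum.swap) (simp add: grad_def grad sum_distrib_left algebra_simps)
  then have lhs: "(\<Sum>i\<in>UNIV. d $ i * grad V q $ i) = (\<Sum>\<alpha>\<in>A. P \<alpha>)"
    unfolding sum.distrib[of _ _ UNIV] \<delta> P_def by (simp add: algebra_simps)
  \<comment> \<open>Component \<open>m\<close> of the Hessian at \<open>d\<close> applied to
    \<open>q\<close>, grouped by the slot that \<open>m\<close> hits, ready for the second
    contraction.\<close>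
  have row: "(\<Sum>l\<in>UNIV. q $ l * partial m (partial l V) d) = (\<Sum>\<alpha>\<in>A. c \<alpha> *
      ((q $ I \<alpha> * d $ K \<alpha> + d $ I \<alpha> * q $ K \<alpha>) * \<delta> m (J \<alpha>)
     + (q $ I \<alpha> * d $ J \<alpha> + d $ I \<alpha> * q $ J \<alpha>) * \<delta> m (K \<alpha>)
     + (q $ J \<alpha> * d $ K \<alpha> + d $ J \<alpha> * q $ K \<alpha>) * \<delta> m (I \<alpha>)))" for m
  proof -
    have "(\<Sum>l\<in>UNIV. q $ l * partial m (partial l V) d) = (\<Sum>\<alpha>\<in>A. \<Sum>l\<in>UNIV.
        (q $ l * c \<alpha> * (\<delta> m (J \<alpha>) * d $ K \<alpha> + d $ J \<alpha> * \<delta> m (K \<alpha>))) * \<delta> l (I \<alpha>)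
      + (q $ l * c \<alpha> * (\<delta> m (I \<alpha>) * d $ K \<alpha> + d $ I \<alpha> * \<delta> m (K \<alpha>))) * \<delta> l (J \<alpha>)
      + (q $ l * c \<alpha> * (\<delta> m (I \<alpha>) * d $ J \<alpha> + d $ I \<alpha> * \<delta> m (J \<alpha>))) * \<delta> l (K \<alpha>))"
      by (subst sum.swap) (simp add: hess sum_distrib_left algebra_simps)
    then show ?thesis
      unfolding sum.distrib[of _ _ UNIV] \<delta> by (simp add: algebra_simps)
  qed
  have "(\<Sum>i\<in>UNIV. \<Sum>j\<in>UNIV. q $ i * q $ j * hessian V d $ i $ j)
      = (\<Sum>m\<in>UNIV. q $ m * (\<Sum>l\<in>UNIV. q $ l * partial m (partial l V) d))"
    by (simp add: hessian_def sum_distrib_left mult.assoc)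
  also have "\<dots> = (\<Sum>\<alpha>\<in>A. \<Sum>m\<in>UNIV.
        (q $ m * c \<alpha> * (q $ I \<alpha> * d $ K \<alpha> + d $ I \<alpha> * q $ K \<alpha>)) * \<delta> m (J \<alpha>)
      + (q $ m * c \<alpha> * (q $ I \<alpha> * d $ J \<alpha> + d $ I \<alpha> * q $ J \<alpha>)) * \<delta> m (K \<alpha>)
      + (q $ m * c \<alpha> * (q $ J \<alpha> * d $ K \<alpha> + d $ J \<alpha> * q $ K \<alpha>)) * \<delta> m (I \<alpha>))"
    unfolding row by (subst sum.swap) (simp add: sum_distrib_left algebra_simps)
  \<comment> \<open>Each product in \<open>P\<close> occurs twice, as the two copies of
    \<open>q\<close> fill their slots in either order.\<close>
  also have "\<dots> = (\<Sum>\<alpha>\<in>A. 2 * P \<alpha>)"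
    unfolding sum.distrib[of _ _ UNIV] \<delta> P_def by (simp add: algebra_simps)
  finally show ?thesis
    unfolding lhs by (simp add: sum_distrib_left)
qed

text \<open>The rank is the dimension of the row space, and dimension 0 leaves no row but the zero
  vector.\<close>

lemma rank_eq_0_imp:
  fixes M :: "complex^'n^'m"
  assumes "rank M = 0"
  shows "M = 0"
proof -
  have "rows M \<subseteq> {0}"
    using assms vec.dim_eq_0[of "rows M"] by (simp add: row_rank_def_gen)
  then have "row i M = 0" for i
    by (auto simp: rows_def)
  then show ?thesis
    by (simp add: vec_eq_iff row_def)
qed

theorem theorem4p2:
  fixes V :: "complex^3 \<Rightarrow> complex" and d0 :: "complex^3"
  assumes "homogeneous_poly 3 V"
    and "\<And>d. proper_darboux_point V d \<Longrightarrow> simple_darboux_point V d"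
    and "improper_darboux_point V d0" and "isotropic d0"
    and "\<nexists>d. improper_darboux_point V d \<and> \<not> isotropic d"
    and "rank (hessian V d0) = 0"
  shows "\<exists>a :: complex^3. a \<noteq> 0 \<and> first_integral V (\<lambda>q p. \<Sum>i\<in>UNIV. a $ i * p $ i)"
proof (intro exI conjI)
  \<comment> \<open>This fixes the witness: the coefficient vector is \<open>d0\<close> itself,
    nonzero because it represents a projective point.\<close>
  show "d0 \<noteq> 0"
    using assms(3) by (simp add: improper_darboux_point_def darboux_point_def)
  have "hessian V d0 = 0"
    using assms(6) by (rule rank_eq_0_imp)
  then have force: "(\<Sum>i\<in>UNIV. d0 $ i * grad V q $ i) = 0" for q
    using hessian_polarization[OF assms(1), of q d0] by simp
  show "first_integral V (\<lambda>q p. \<Sum>i\<in>UNIV. d0 $ i * p $ i)"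
    unfolding first_integral_def
  proof (intro allI impI, elim conjE)
    fix T and q p :: "complex \<Rightarrow> complex^3"
    assume T: "open T" "connected T" and sol: "hamiltonian_solution V T q p"
    have "((\<lambda>t. \<Sum>i\<in>UNIV. d0 $ i * p t $ i) has_field_derivative 0) (at t)" if "t \<in> T" for t
    proof -
      \<comment> \<open>Hamilton's equations turn the derivative into minus the pairing of
        \<open>d0\<close> with the gradient, which \<open>force\<close> makes vanish.\<close>
      have "((\<lambda>t. \<Sum>i\<in>UNIV. d0 $ i * p t $ i) has_field_derivative
          (\<Sum>i\<in>UNIV. d0 $ i * - (grad V (q t) $ i))) (at t)"
        using sol that unfolding hamiltonian_solution_def
        by (intro DERIV_sum DERIV_cmult) blast
      then show ?thesis
        using force[of "q t"] by (simp add: sum_negf)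
    qed
    \<comment> \<open>The set \<open>K\<close> collects exceptional points without a derivative
      condition; here there are none.\<close>
    then show "(\<lambda>t. \<Sum>i\<in>UNIV. d0 $ i * p t $ i) constant_on T"
      using T by (intro DERIV_zero_connected_constant_on[where K = "{}"])
        (auto intro: continuous_at_imp_continuous_on DERIV_isCont)
  qed
qed

end
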